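(* Let $X$ be an infinite Fort space with particular point $b$, and let $C, D$ be nonempty subsets of $X$. Then there exist a nonzero cardinal number $\lambda$ and a $C-(X,D,\lambda)$ Top-design of type 3 if and only if all of the following hold: $b\notin C\setminus D$, ${\rm card}(C\setminus\{b\})\leq{\rm card}(D\setminus\{b\})$, and ${\rm card}(X\setminus(D\cup\{b\}))\leq{\rm card}(X\setminus(C\cup\{b\}))$.
   Context: A Fort space with particular point $b$ is a set $X$ with $b\in X$, equipped with the topology $\{U\subseteq X: b\notin U \text{ or } X\setminus U \text{ is finite}\}$. Subsets of $X$ carry the subspace topology, and $S\approx T$ means that $S$ and $T$ are homeomorphic. For a topological space $X$, nonempty subsets $C,D$ of $X$ and a nonzero (possibly infinite) cardinal number $\lambda$, a collection $\mathbb{A}$ of subsets of $X$ is a $C-(X,D,\lambda)$ Top-design of type 3 if: (i) for every $B\in\mathbb{A}$, $B\approx D$ and $X\setminus B\approx X\setminus D$; and (ii) for every $E\subseteq X$ with $E\approx C$ and $X\setminus E\approx X\setminus C$, ${\rm card}(\{B\in\mathbb{A}:E\subseteq B\})=\lambda$. *)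

theory Defs
  imports "HOL-Analysis.Analysis"
begin

unbundle cardinal_syntax

definition fort_space :: "'a topology \<Rightarrow> 'a \<Rightarrow> bool" where
  "fort_space X b \<longleftrightarrow> b \<in> topspace X \<and>
     (\<forall>U. openin X U \<longleftrightarrow> U \<subseteq> topspace X \<and> (b \<notin> U \<or> finite (topspace X - U)))"

lemma istopology_fort: "istopology (\<lambda>U. U \<subseteq> S \<and> (b \<notin> U \<or> finite (S - U)))"
  unfolding istopology_def
proof (intro conjI allI impI)
  fix U V assume U: "U \<subseteq> S \<and> (b \<notin> U \<or> finite (S - U))" and V: "V \<subseteq> S \<and> (b \<notin> V \<or> finite (S - V))"
  show "U \<inter> V \<subseteq> S" using U by blast
  show "b \<notin> U \<inter> V \<or> finite (S - U \<inter> V)" using U V by (auto simp: Diff_Int)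
next
  fix K assume K: "\<forall>U\<in>K. U \<subseteq> S \<and> (b \<notin> U \<or> finite (S - U))"
  show "\<Union>K \<subseteq> S" using K by blast
  show "b \<notin> \<Union>K \<or> finite (S - \<Union>K)"
  proof (cases "b \<in> \<Union>K")
    case True
    then obtain U where "U \<in> K" "b \<in> U" by blast
    then have "finite (S - U)" "S - \<Union>K \<subseteq> S - U" using K by auto
    then show ?thesis using finite_subset by blast
  qed simp
qed

lemma fort_space_exists:
  assumes "b \<in> S"
  shows "\<exists>X. topspace X = S \<and> fort_space X b"
proof -
  let ?P = "\<lambda>U. U \<subseteq> S \<and> (b \<notin> U \<or> finite (S - U))"
  have op: "openin (topology ?P) = ?P"
    by (rule topology_inverse'[OF istopology_fort])
  have "topspace (topology ?P) = S"
    unfolding topspace_def op by (rule subset_antisym) (blast, rule Union_upper, simp)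
  then show ?thesis
    using assms op by (intro exI[of _ "topology ?P"]) (simp add: fort_space_def)
qed

definition subset_homeo :: "'a topology \<Rightarrow> 'a set \<Rightarrow> 'a set \<Rightarrow> bool" where
  "subset_homeo X S T \<longleftrightarrow> subtopology X S homeomorphic_space subtopology X T"

text \<open>The cardinal number is given by a representing cardinal order \<open>lam\<close>. That the base
  topological space is arbitrary, that \<open>C\<close> and \<open>D\<close> are nonempty subsets of it, and that \<open>lam\<close> is a
  nonzero cardinal are standing assumptions, to be imposed wherever the notion is used.\<close>

definition top_design3 ::
    "'a set \<Rightarrow> 'a topology \<Rightarrow> 'a set \<Rightarrow> 'k rel \<Rightarrow> 'a set set \<Rightarrow> bool" where
  "top_design3 C X D lam \<A> \<longleftrightarrow>
     \<A> \<subseteq> Pow (topspace X) \<and>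
     (\<forall>B\<in>\<A>. subset_homeo X B D \<and> subset_homeo X (topspace X - B) (topspace X - D)) \<and>
     (\<forall>E. E \<subseteq> topspace X \<and> subset_homeo X E C \<and>
          subset_homeo X (topspace X - E) (topspace X - C) \<longrightarrow>
          |{B \<in> \<A>. E \<subseteq> B}| =o lam)"

text \<open>Existence of a nonzero cardinal can be stated over the type \<open>'a set rel\<close> without loss of
  generality: taking \<open>E = C\<close> in the definition shows that \<open>lam\<close> is the cardinality of a set of
  subsets of the space.\<close>

end

theory Submission
  imports Defs
begin

text \<open>
  The condition imposed on blocks and on covered sets is an orbit relation. The self-homeomorphisms
  of an infinite Fort space \<open>X\<close> are the permutations of \<open>X\<close> fixing
  \<open>b\<close>, and \<open>S\<close> and \<open>T\<close>, as well as their complements, are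
  homeomorphic if and only if such a permutation carries \<open>S\<close> onto \<open>T\<close>
  (lemma \<open>subset_homeo_pair_iff_symmetric\<close>). The nontrivial direction works because an
  infinite subspace is discrete exactly when it misses \<open>b\<close>; one of \<open>S\<close> and
  \<open>X - S\<close> is infinite, and so detects on which side \<open>b\<close> lies. After that
  only the cardinalities of the two sides, with \<open>b\<close> removed, matter.

  Consequently, if any block \<open>B\<close> in the orbit of \<open>D\<close> contains
  \<open>C\<close>, then the whole orbit of \<open>D\<close> is a design: a permutation moving
  \<open>E\<close> to \<open>C\<close> matches the blocks above \<open>E\<close> with those above
  \<open>C\<close>, so their number does not depend on \<open>E\<close> and is nonzero. Conversely,
  any design with nonzero \<open>\<lambda>\<close> has a block containing \<open>C\<close>. The
  theorem therefore asks when some \<open>B\<close> in the orbit of \<open>D\<close> contains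
  \<open>C\<close>. The three conditions are clearly necessary. Their sufficiency is a statement
  about bare infinite sets (lemma \<open>exists_superset_of_type\<close>), applied inside
  \<open>X - {b}\<close> to \<open>C - {b}\<close> and \<open>D - {b}\<close>: a superset of the first can be
  chosen so that it and its complement have the same cardinalities as the second and its complement.
\<close>

section \<open>Splitting an infinite set\<close>

lemma lepoll_iff_card_of_ordLeq: "A \<lesssim> B \<longleftrightarrow> |A| \<le>o |B|"
  by (simp add: lepoll_def card_of_ordLeq)

lemma infinite_Un_lepoll:
  assumes "infinite D" "A \<lesssim> D" "B \<lesssim> D"
  shows "A \<union> B \<lesssim> D"
  using card_of_Un_ordLeq_infinite_Field[of "|D|" A B] assms card_of_Card_order[of D]
  by (simp add: lepoll_iff_card_of_ordLeq Field_card_of)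

text \<open>If neither part of \<open>Y\<close> had full cardinality, their union would be too small.\<close>

lemma infinite_Diff_eqpoll:
  assumes Y: "infinite Y" and CY: "C \<subseteq> Y" and nC: "\<not> C \<approx> Y"
  shows "Y - C \<approx> Y"
proof (rule ccontr)
  assume n: "\<not> Y - C \<approx> Y"
  have "C \<lesssim> Y" "Y - C \<lesssim> Y"
    using CY by (auto intro: subset_imp_lepoll)
  then have "|C| <o |Y|" "|Y - C| <o |Y|"
    using nC n by (auto simp: lepoll_iff_card_of_ordLeq eqpoll_iff_card_of_ordIso ordLeq_iff_ordLess_or_ordIso)
  from card_of_Un_ordLess_infinite[OF Y this] have "|Y| <o |Y|"
    using CY by (simp add: Un_absorb1)
  then show False
    using ordLess_irreflexive by blast
qed

text \<open>How to enlarge \<open>C\<close> depends on the side that leaves room. For finite \<open>D\<close>,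
  finitely many points are added to \<open>C\<close>, and cofinite subsets of \<open>Y\<close> all have full size. If
  \<open>C\<close> has full size, then so does \<open>D\<close>, and it is the complement that has to be cut to
  size, everything else going into \<open>B\<close>. In the remaining case \<open>Y - C\<close> has full size, so that a
  bijection copies onto it the whole partition of \<open>Y\<close> into \<open>D\<close> and its complement; adjoining \<open>C\<close>
  to the copy of the infinite set \<open>D\<close> does not enlarge it.\<close>

lemma exists_superset_of_type:
  assumes Y: "infinite Y" and CY: "C \<subseteq> Y" and DY: "D \<subseteq> Y"
    and CD: "C \<lesssim> D" and co: "Y - D \<lesssim> Y - C"
  obtains B where "C \<subseteq> B" "B \<subseteq> Y" "B \<approx> D" "Y - B \<approx> Y - D"
proof -
  consider "finite D" | "C \<approx> Y" | "infinite D" "\<not> C \<approx> Y" by blast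
  then show thesis
  proof cases
    case 1
    then have finC: "finite C"
      using CD by (auto simp: lepoll_def intro: inj_on_finite)
    then have le: "card C \<le> card D"
      using CD 1 by (simp add: lepoll_iff_card_le)
    have "infinite (Y - C)" using Y finC by simp
    then obtain F where F: "finite F" "card F = card D - card C" "F \<subseteq> Y - C"
      using infinite_arbitrarily_large by blast
    have "card (C \<union> F) = card D"
      using F finC le by (subst card_Un_disjoint) auto
    then have BD: "C \<union> F \<approx> D"
      using F finC 1 by (simp add: eqpoll_iff_card)
    have cofin: "Y - S \<approx> Y" if "finite S" "S \<subseteq> Y" for S
      using infinite_Diff_eqpoll[OF Y that(2)] eqpoll_finite_iff[of S Y] Y that(1) by blast
    have "Y - (C \<union> F) \<approx> Y - D"
      using cofin[of "C \<union> F"] cofin[of D] F finC CY DY 1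
      by (blast intro: eqpoll_trans eqpoll_sym)
    then show thesis
      using that[of "C \<union> F"] BD F CY by blast
  next
    case 2
    obtain Z where Z: "Z \<subseteq> Y - C" "Z \<approx> Y - D"
      using co unfolding lepoll_def by (metis eqpoll_def eqpoll_sym inj_on_imp_bij_betw)
    have "Y - Z \<lesssim> C"
      using 2 by (meson Diff_subset eqpoll_sym lepoll_trans2 subset_imp_lepoll)
    then have "Y - Z \<lesssim> D" using CD lepoll_trans by blast
    moreover have "C \<lesssim> Y - Z" using Z CY by (intro subset_imp_lepoll) blast
    then have "D \<lesssim> Y - Z"
      using DY 2 by (meson eqpoll_sym lepoll_trans lepoll_trans2 subset_imp_lepoll)
    ultimately have "Y - Z \<approx> D" by (rule lepoll_antisym)
    moreover have "Y - (Y - Z) = Z" using Z by blast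
    ultimately show thesis
      using that[of "Y - Z"] Z CY by auto
  next
    case 3
    then obtain f where f: "bij_betw f Y (Y - C)"
      using infinite_Diff_eqpoll[OF Y CY] eqpoll_sym unfolding eqpoll_def by blast
    then have inj: "inj_on f Y" and im: "f ` Y = Y - C"
      by (auto simp: bij_betw_def)
    have fD: "f ` D \<approx> D" "f ` (Y - D) \<approx> Y - D"
      using inj DY by (auto intro!: inj_on_image_eqpoll_self elim: inj_on_subset)
    have "C \<union> f ` D \<lesssim> D"
      using 3 CD fD by (intro infinite_Un_lepoll) (auto intro: eqpoll_imp_lepoll)
    moreover have "D \<lesssim> C \<union> f ` D"
      using fD by (meson eqpoll_sym lepoll_trans1 subset_imp_lepoll sup_ge2)
    ultimately have BD: "C \<union> f ` D \<approx> D" by (rule lepoll_antisym)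
    have "Y - (C \<union> f ` D) = f ` (Y - D)"
      using inj_on_image_set_diff[OF inj, of Y D] DY im by (simp add: set_diff_eq)
    moreover have "f ` D \<subseteq> Y" using image_mono[OF DY, of f] im by blast
    ultimately show thesis
      using that[of "C \<union> f ` D"] BD fD CY by auto
  qed
qed

section \<open>Symmetries of a Fort space\<close>

definition fort_symmetry :: "'a topology \<Rightarrow> 'a \<Rightarrow> ('a \<Rightarrow> 'a) \<Rightarrow> bool" where
  "fort_symmetry X b p \<longleftrightarrow> bij_betw p (topspace X) (topspace X) \<and> p b = b"

lemma fort_symmetry_inv:
  assumes "b \<in> topspace X" "fort_symmetry X b p"
  shows "fort_symmetry X b (inv_into (topspace X) p)"
  using assms bij_betw_inv_into_left[of p "topspace X" "topspace X" b]
  by (auto simp: fort_symmetry_def bij_betw_inv_into)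

lemma fort_symmetry_comp:
  "fort_symmetry X b p \<Longrightarrow> fort_symmetry X b q \<Longrightarrow> fort_symmetry X b (q \<circ> p)"
  by (auto simp: fort_symmetry_def intro: bij_betw_trans)

lemma fort_symmetry_open:
  assumes X: "fort_space X b" and p: "fort_symmetry X b p" and U: "openin X U"
  shows "openin X (p ` U)"
proof -
  let ?S = "topspace X"
  have bS: "b \<in> ?S" and US: "U \<subseteq> ?S" and U': "b \<notin> U \<or> finite (?S - U)"
    using X U by (auto simp: fort_space_def)
  have inj: "inj_on p ?S" and im: "p ` ?S = ?S" and pb: "p b = b"
    using p by (auto simp: fort_symmetry_def bij_betw_def)
  have "?S - p ` U = p ` (?S - U)"
    using inj_on_image_set_diff[OF inj, of ?S U] US im by auto
  moreover have "b \<in> U" if "b \<in> p ` U"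
    using inj_on_image_mem_iff[OF inj bS US] that pb by simp
  ultimately have "b \<notin> p ` U \<or> finite (?S - p ` U)"
    using U' by auto
  then show ?thesis
    using X US im by (auto simp: fort_space_def)
qed

text \<open>The topology is determined by \<open>b\<close> and the finite sets, so a permutation fixing \<open>b\<close>
  preserves it, as does its inverse, which gives continuity.\<close>

lemma homeomorphic_map_fort_symmetry:
  assumes X: "fort_space X b" and p: "fort_symmetry X b p"
  shows "homeomorphic_map X X p"
proof -
  let ?q = "inv_into (topspace X) p"
  have q: "fort_symmetry X b ?q"
    using X p by (intro fort_symmetry_inv) (auto simp: fort_space_def)
  have bij: "bij_betw p (topspace X) (topspace X)"
    using p by (simp add: fort_symmetry_def)
  have "continuous_map X X p"
    unfolding continuous_map_def
  proof (intro conjI allI impI)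
    show "p \<in> topspace X \<rightarrow> topspace X"
      using bij by (auto simp: bij_betw_def)
    fix U assume U: "openin X U"
    have "{x \<in> topspace X. p x \<in> U} = ?q ` U"
    proof (intro set_eqI iffI)
      fix x assume "x \<in> {x \<in> topspace X. p x \<in> U}"
      then show "x \<in> ?q ` U"
        using bij_betw_inv_into_left[OF bij, of x] by (auto intro: rev_image_eqI)
    next
      fix x assume "x \<in> ?q ` U"
      then obtain u where u: "u \<in> U" "x = ?q u" by blast
      have "u \<in> topspace X" using u(1) openin_subset[OF U] by blast
      then show "x \<in> {x \<in> topspace X. p x \<in> U}"
        using u bij_betw_inv_into_right[OF bij] bij_betw_apply[OF bij_betw_inv_into[OF bij]] by simp
    qed
    then show "openin X {x \<in> topspace X. p x \<in> U}"
      using fort_symmetry_open[OF X q U] by simp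
  qed
  moreover have "open_map X X p"
    using fort_symmetry_open[OF X p] by (simp add: open_map_def)
  ultimately show ?thesis
    using bij by (intro bijective_open_imp_homeomorphic_map) (auto simp: bij_betw_def)
qed

text \<open>Bijections between the two sides, with \<open>b\<close> set apart, glue to one permutation.\<close>

lemma fort_symmetry_extending:
  assumes b: "b \<in> topspace X" and S: "S \<subseteq> topspace X" and T: "T \<subseteq> topspace X"
    and bST: "b \<in> S \<longleftrightarrow> b \<in> T"
    and eq: "S - {b} \<approx> T - {b}"
    and co: "topspace X - (S \<union> {b}) \<approx> topspace X - (T \<union> {b})"
  obtains p where "fort_symmetry X b p" "p ` S = T"
proof -
  let ?X = "topspace X"
  obtain f where f: "bij_betw f (S - {b}) (T - {b})" using eq by (auto simp: eqpoll_def)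
  obtain g where g: "bij_betw g (?X - (S \<union> {b})) (?X - (T \<union> {b}))" using co by (auto simp: eqpoll_def)
  define p where "p x = (if x = b then b else if x \<in> S then f x else g x)" for x
  have pf: "bij_betw p (S - {b}) (T - {b})"
    using f by (rule bij_betw_cong[THEN iffD1, rotated]) (auto simp: p_def)
  have pg: "bij_betw p (?X - (S \<union> {b})) (?X - (T \<union> {b}))"
    using g by (rule bij_betw_cong[THEN iffD1, rotated]) (auto simp: p_def)
  have pb: "bij_betw p {b} {b}" by (simp add: p_def)
  have "bij_betw p ((S - {b}) \<union> (?X - (S \<union> {b}))) ((T - {b}) \<union> (?X - (T \<union> {b})))"
    by (rule bij_betw_combine[OF pf pg]) blast
  then have "bij_betw p ((S - {b}) \<union> (?X - (S \<union> {b})) \<union> {b}) ((T - {b}) \<union> (?X - (T \<union> {b})) \<union> {b})"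
    by (rule bij_betw_combine[OF _ pb]) blast
  moreover have "(S - {b}) \<union> (?X - (S \<union> {b})) \<union> {b} = ?X" "(T - {b}) \<union> (?X - (T \<union> {b})) \<union> {b} = ?X"
    using S T b by auto
  ultimately have "fort_symmetry X b p"
    by (simp add: fort_symmetry_def p_def)
  moreover have "p ` S = T"
  proof (cases "b \<in> S")
    case True
    then have "p ` S = insert b (p ` (S - {b}))" by (auto simp: p_def)
    then show ?thesis using pf True bST by (auto simp: bij_betw_def)
  next
    case False
    then show ?thesis using pf bST by (simp add: bij_betw_def)
  qed
  ultimately show thesis by (rule that)
qed

text \<open>The topological property that detects \<open>b\<close>: every neighbourhood of \<open>b\<close> meets an infinite
  set containing \<open>b\<close> in infinitely many points, while all other points are isolated.\<close>

lemma fort_subspace_discrete_iff: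
  assumes X: "fort_space X b" and S: "S \<subseteq> topspace X"
  shows "(\<forall>x\<in>S. openin (subtopology X S) {x}) \<longleftrightarrow> b \<notin> S \<or> finite S"
proof
  assume disc: "\<forall>x\<in>S. openin (subtopology X S) {x}"
  show "b \<notin> S \<or> finite S"
  proof (rule disjCI)
    assume "\<not> finite S"
    show "b \<notin> S"
    proof
      assume "b \<in> S"
      then obtain U where U: "openin X U" "{b} = U \<inter> S"
        using disc unfolding openin_subtopology by blast
      then have "finite (topspace X - U)" using X unfolding fort_space_def by blast
      moreover have "S \<subseteq> insert b (topspace X - U)" using U S by blast
      ultimately show False using \<open>infinite S\<close> finite_subset by blast
    qed
  qed
next
  assume fin: "b \<notin> S \<or> finite S"
  show "\<forall>x\<in>S. openin (subtopology X S) {x}"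
  proof
    fix x assume x: "x \<in> S"
    let ?U = "insert x (topspace X - S)"
    have "openin X ?U \<or> openin X {x}"
    proof (cases "x = b")
      case True
      then have "finite (topspace X - ?U)"
        using fin x by (intro finite_subset[of "topspace X - ?U" S]) auto
      then show ?thesis using X x S by (auto simp: fort_space_def)
    next
      case False
      then show ?thesis using X x S by (auto simp: fort_space_def)
    qed
    moreover have "{x} = ?U \<inter> S" "{x} = {x} \<inter> S" using x by auto
    ultimately show "openin (subtopology X S) {x}"
      unfolding openin_subtopology by metis
  qed
qed

lemma homeomorphic_discrete_iff:
  assumes "X homeomorphic_space Y"
  shows "(\<forall>x\<in>topspace X. openin X {x}) \<longleftrightarrow> (\<forall>y\<in>topspace Y. openin Y {y})"
proof -
  obtain f where f: "homeomorphic_map X Y f"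
    using assms by (auto simp: homeomorphic_space)
  have "openin Y {f x} \<longleftrightarrow> openin X {x}" if "x \<in> topspace X" for x
    using homeomorphic_map_openness[OF f, of "{x}"] that by simp
  moreover have "topspace Y = f ` topspace X"
    using homeomorphic_imp_surjective_map[OF f] by simp
  ultimately show ?thesis by auto
qed

lemma subset_homeo_imp_eqpoll:
  assumes "S \<subseteq> topspace X" "T \<subseteq> topspace X" "subset_homeo X S T"
  shows "S \<approx> T"
proof -
  obtain f where f: "homeomorphic_map (subtopology X S) (subtopology X T) f"
    using assms(3) by (auto simp: homeomorphic_space subset_homeo_def)
  have "bij_betw f S T"
    using homeomorphic_imp_injective_map[OF f] homeomorphic_imp_surjective_map[OF f] assms(1,2)
    by (simp add: bij_betw_def Int_absorb1)
  then show ?thesis by (auto simp: eqpoll_def)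
qed

lemma subset_homeo_infinite_mem_iff:
  assumes X: "fort_space X b" and S: "S \<subseteq> topspace X" and T: "T \<subseteq> topspace X"
    and h: "subset_homeo X S T" and inf: "infinite S"
  shows "b \<in> S \<longleftrightarrow> b \<in> T"
proof -
  have "infinite T"
    using subset_homeo_imp_eqpoll[OF S T h] inf by (simp add: eqpoll_finite_iff)
  then show ?thesis
    using homeomorphic_discrete_iff[OF h[unfolded subset_homeo_def]] S T inf
      fort_subspace_discrete_iff[OF X S] fort_subspace_discrete_iff[OF X T]
    by (simp add: Int_absorb1)
qed

lemma Diff_singleton_eqpoll:
  assumes "S \<approx> T" "b \<in> S \<longleftrightarrow> b \<in> T"
  shows "S - {b} \<approx> T - {b}"
proof (cases "b \<in> S")
  case True
  then have "insert b (S - {b}) \<approx> insert b (T - {b})"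
    using assms by (simp add: insert_absorb)
  then show ?thesis by (rule insert_eqpoll_insertD) auto
next
  case False
  then show ?thesis using assms by simp
qed

text \<open>A finite subspace is discrete whether or not it contains \<open>b\<close>, so a homeomorphism
  between \<open>S\<close> and \<open>T\<close> alone need not come from a symmetry. Requiring it on complements as well repairs
  this, because \<open>S\<close> or its complement is infinite and its type decides the side of \<open>b\<close>.\<close>

lemma subset_homeo_pair_iff_symmetric:
  assumes X: "fort_space X b" and inf: "infinite (topspace X)"
    and S: "S \<subseteq> topspace X" and T: "T \<subseteq> topspace X"
  shows "subset_homeo X S T \<and> subset_homeo X (topspace X - S) (topspace X - T) \<longleftrightarrow>
    (\<exists>p. fort_symmetry X b p \<and> p ` S = T)"
proof
  assume h: "subset_homeo X S T \<and> subset_homeo X (topspace X - S) (topspace X - T)"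
  have bX: "b \<in> topspace X" using X by (simp add: fort_space_def)
  have "infinite S \<or> infinite (topspace X - S)"
    using inf S finite_Diff2 by blast
  then have b: "b \<in> S \<longleftrightarrow> b \<in> T"
    using subset_homeo_infinite_mem_iff[OF X S T] bX h
      subset_homeo_infinite_mem_iff[OF X, of "topspace X - S" "topspace X - T"] by blast
  have "S - {b} \<approx> T - {b}"
    using subset_homeo_imp_eqpoll[OF S T] h b by (blast intro: Diff_singleton_eqpoll)
  moreover have "topspace X - S - {b} \<approx> topspace X - T - {b}"
    using subset_homeo_imp_eqpoll[of "topspace X - S" X "topspace X - T"] h b bX
    by (intro Diff_singleton_eqpoll) auto
  then have "topspace X - (S \<union> {b}) \<approx> topspace X - (T \<union> {b})"
    by (simp add: set_diff_eq Un_def)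
  ultimately show "\<exists>p. fort_symmetry X b p \<and> p ` S = T"
    using fort_symmetry_extending[OF bX S T b] by metis
next
  assume "\<exists>p. fort_symmetry X b p \<and> p ` S = T"
  then obtain p where p: "fort_symmetry X b p" "p ` S = T" by blast
  have hp: "homeomorphic_map X X p" by (rule homeomorphic_map_fort_symmetry[OF X p(1)])
  have "p ` (topspace X - S) = topspace X - T"
    using p S inj_on_image_set_diff[of p "topspace X" "topspace X" S]
    by (auto simp: fort_symmetry_def bij_betw_def)
  moreover have "subset_homeo X A (p ` A)" if "A \<subseteq> topspace X" for A
    using that unfolding subset_homeo_def
    by (intro homeomorphic_map_imp_homeomorphic_space[of _ _ p] homeomorphic_map_subtopologies[OF hp])
      (use homeomorphic_imp_surjective_map[OF hp] in blast)
  ultimately show "subset_homeo X S T \<and> subset_homeo X (topspace X - S) (topspace X - T)"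
    using p S by (metis Diff_subset)
qed

section \<open>Existence of designs\<close>

theorem theorem2p5:
  fixes X :: "'a topology" and b :: 'a and C D :: "'a set"
  assumes "fort_space X b"
    and "infinite (topspace X)"
    and "C \<subseteq> topspace X" and "C \<noteq> {}"
    and "D \<subseteq> topspace X" and "D \<noteq> {}"
  shows "(\<exists>lam :: 'a set rel. Cnotzero lam \<and> (\<exists>\<A>. top_design3 C X D lam \<A>)) \<longleftrightarrow>
    b \<notin> C - D \<and>
    |C - {b}| \<le>o |D - {b}| \<and>
    |topspace X - (D \<union> {b})| \<le>o |topspace X - (C \<union> {b})|"
    (is "?design \<longleftrightarrow> ?card")
proof -
  let ?X = "topspace X"
  note pair = subset_homeo_pair_iff_symmetric[OF assms(1,2)]
  have bX: "b \<in> ?X" using assms(1) by (simp add: fort_space_def)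
  have card: "?card \<longleftrightarrow> b \<notin> C - D \<and> C - {b} \<lesssim> D - {b} \<and> ?X - (D \<union> {b}) \<lesssim> ?X - (C \<union> {b})"
    by (simp add: lepoll_iff_card_of_ordLeq)
  show ?thesis
  proof
    assume ?design
    then obtain lam :: "'a set rel" and \<A> where lam: "Cnotzero lam" and des: "top_design3 C X D lam \<A>"
      by blast
    have "|{B \<in> \<A>. C \<subseteq> B}| =o lam"
      using des assms(3) unfolding top_design3_def subset_homeo_def by auto
    then have "{B \<in> \<A>. C \<subseteq> B} \<noteq> {}"
      using lam ordIso_symmetric[of _ lam] ordIso_transitive[OF _ card_of_empty_ordIso]
      unfolding czero_def by force
    \<comment> \<open>\<open>C\<close> is one of the sets \<open>E\<close> to be covered, so a nonzero count yields a block above it.\<close>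
    then obtain B where B: "B \<in> \<A>" "C \<subseteq> B" by blast
    then have BX: "B \<subseteq> ?X" using des by (auto simp: top_design3_def)
    obtain p where p: "fort_symmetry X b p" "p ` B = D"
      using pair[OF BX assms(5)] des B by (auto simp: top_design3_def)
    have inj: "inj_on p ?X" and im: "p ` ?X = ?X" and pb: "p b = b"
      using p by (auto simp: fort_symmetry_def bij_betw_def)
    have "p ` (C - {b}) \<subseteq> D - {b}"
      using B BX bX p(2) pb inj by (auto simp: inj_on_def)
    moreover have "inj_on p (C - {b})" using inj by (rule inj_on_subset) (use B BX in auto)
    ultimately have "C - {b} \<lesssim> D - {b}" by (auto simp: lepoll_def)
    moreover have "?X - (D \<union> {b}) \<subseteq> p ` (?X - (C \<union> {b}))"
    proof
      fix y assume y: "y \<in> ?X - (D \<union> {b})"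
      then obtain x where "x \<in> ?X" "y = p x" using im by blast
      then show "y \<in> p ` (?X - (C \<union> {b}))" using y p(2) pb B(2) by blast
    qed
    then have "?X - (D \<union> {b}) \<lesssim> ?X - (C \<union> {b})" by (rule subset_image_lepoll)
    moreover have "b \<notin> C - D" using B p(2) pb by force
    ultimately show ?card using card by blast
  next
    assume ?card
    then have bCD: "b \<notin> C - D" and CD: "C - {b} \<lesssim> D - {b}"
      and co: "?X - (D \<union> {b}) \<lesssim> ?X - (C \<union> {b})"
      using card by auto
    have ds: "?X - {b} - (S - {b}) = ?X - (S \<union> {b})" for S by blast
    obtain B' where B': "C - {b} \<subseteq> B'" "B' \<subseteq> ?X - {b}" "B' \<approx> D - {b}"
      "?X - {b} - B' \<approx> ?X - {b} - (D - {b})"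
    proof (rule exists_superset_of_type[of "?X - {b}" "C - {b}" "D - {b}"])
      show "infinite (?X - {b})" using assms(2) by simp
      show "C - {b} \<subseteq> ?X - {b}" "D - {b} \<subseteq> ?X - {b}" using assms(3,5) by auto
      show "?X - {b} - (D - {b}) \<lesssim> ?X - {b} - (C - {b})" using co by (simp only: ds)
    qed (use CD in auto)
    \<comment> \<open>The particular point goes back in exactly when \<open>D\<close> has it.\<close>
    define B where "B = B' \<union> (D \<inter> {b})"
    have B: "C \<subseteq> B" "B \<subseteq> ?X" "b \<in> B \<longleftrightarrow> b \<in> D" "B - {b} = B'" "?X - (B \<union> {b}) = ?X - {b} - B'"
      using B' bCD bX by (auto simp: B_def)
    obtain r where r: "fort_symmetry X b r" "r ` B = D"
      by (rule fort_symmetry_extending[OF bX B(2) assms(5) B(3)]) (use B B' in \<open>auto simp: ds\<close>)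
    \<comment> \<open>All images of \<open>D\<close> under symmetries: a full orbit, hence stable under every symmetry.\<close>
    define \<A> where "\<A> = {B. B \<subseteq> ?X \<and> (\<exists>p. fort_symmetry X b p \<and> p ` B = D)}"
    let ?lam = "|{B \<in> \<A>. C \<subseteq> B}|"
    have "{B \<in> \<A>. C \<subseteq> B} \<noteq> {}"
      using B r by (auto simp: \<A>_def)
    then have nz: "Cnotzero ?lam"
      by (simp only: card_of_ordIso_czero_iff_empty card_of_Card_order simp_thms)
    \<comment> \<open>A symmetry carrying \<open>E\<close> to \<open>F\<close> permutes \<open>\<A>\<close>, so the members above \<open>F\<close> are
      at least as numerous as those above \<open>E\<close>; applied also to the inverse symmetry, this is
      what makes the count independent of \<open>E\<close>.\<close>
    have through: "{B \<in> \<A>. E \<subseteq> B} \<lesssim> {B \<in> \<A>. F \<subseteq> B}"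
      if p: "fort_symmetry X b p" "p ` E = F" for p E F
    proof -
      have bij: "bij_betw p ?X ?X" using p by (simp add: fort_symmetry_def)
      have "p ` B \<in> \<A>" if "B \<in> \<A>" for B
      proof -
        obtain q where BX: "B \<subseteq> ?X" and q: "fort_symmetry X b q" "q ` B = D"
          using \<open>B \<in> \<A>\<close> by (auto simp: \<A>_def)
        have "fort_symmetry X b (q \<circ> inv_into ?X p)"
          using p q bX by (blast intro: fort_symmetry_comp fort_symmetry_inv)
        moreover have "(q \<circ> inv_into ?X p) ` p ` B = D"
          using bij_betw_imp_inj_on[OF bij] BX q(2)
          by (simp only: image_comp[symmetric] inv_into_image_cancel)
        moreover have "p ` B \<subseteq> ?X" using bij BX by (auto simp: bij_betw_def)
        ultimately show ?thesis unfolding \<A>_def by blast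
      qed
      then have "(`) p ` {B \<in> \<A>. E \<subseteq> B} \<subseteq> {B \<in> \<A>. F \<subseteq> B}" using p by blast
      moreover have "inj_on ((`) p) {B \<in> \<A>. E \<subseteq> B}"
        using bij by (intro inj_on_subset[OF inj_on_image_Pow]) (auto simp: bij_betw_def \<A>_def)
      ultimately show ?thesis unfolding lepoll_def by blast
    qed
    have "top_design3 C X D ?lam \<A>"
      unfolding top_design3_def
    proof (intro conjI allI impI ballI)
      show "\<A> \<subseteq> Pow ?X" by (auto simp: \<A>_def)
    next
      fix B assume "B \<in> \<A>"
      then show "subset_homeo X B D" "subset_homeo X (?X - B) (?X - D)"
        using pair[of B D] assms(5) by (auto simp: \<A>_def)
    next
      fix E assume E: "E \<subseteq> ?X \<and> subset_homeo X E C \<and> subset_homeo X (?X - E) (?X - C)"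
      then obtain p where p: "fort_symmetry X b p" "p ` E = C"
        using pair[of E C] assms(3) by blast
      have "inv_into ?X p ` C = E"
        using p E by (auto simp: fort_symmetry_def bij_betw_def inv_into_image_cancel)
      then have "{B \<in> \<A>. E \<subseteq> B} \<approx> {B \<in> \<A>. C \<subseteq> B}"
        using through[OF p] through[OF fort_symmetry_inv[OF bX p(1)]] by (blast intro: lepoll_antisym)
      then show "|{B \<in> \<A>. E \<subseteq> B}| =o ?lam"
        by (simp add: eqpoll_iff_card_of_ordIso)
    qed
    with nz show ?design by blast
  qed
qed

end
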